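(* Let $G$ be a finite non-solvable group. Then \[ \frac{2(|G|-|\mathrm{Sol}(G)|)}{|G|^2} + \frac{2|\mathrm{Sol}(G)|}{|G|} - \frac{|\mathrm{Sol}(G)|^2}{|G|^2} \leq P_S(G) \leq 1 - \frac{6(|G|-|\mathrm{Sol}(G)|)}{|G|^2}. \]
   Context: For a group $G$, $\mathrm{Sol}(G)=\{x\in G : \langle x,y\rangle \text{ is solvable for all } y\in G\}$. For a finite group $G$, the solvability degree of $G$ is \[ P_S(G)=\frac{|\{(u,v)\in G\times G : \langle u,v\rangle \text{ is solvable}\}|}{|G|^2}. \] *)

theory Defs
  imports Complex_Main "HOL-Algebra.Algebra"
begin

definition Sol :: "('a, 'b) monoid_scheme \<Rightarrow> 'a set"
  where "Sol G = {x \<in> carrier G. \<forall>y \<in> carrier G. solvable (subgroup_generated G {x, y})}"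

definition solvability_degree :: "('a, 'b) monoid_scheme \<Rightarrow> real"
  where "solvability_degree G =
    real (card {(u, v) \<in> carrier G \<times> carrier G. solvable (subgroup_generated G {u, v})})
      / (real (order G))\<^sup>2"

end

theory Submission
  imports Defs
begin

text \<open>The pairs \<open>(u, v)\<close> generating a solvable subgroup are counted row by row. Write \<open>g\<close> for the order
of \<open>G\<close> and \<open>s\<close> for the number of elements of \<open>Sol G\<close>. A row with \<open>u \<in> Sol G\<close> contributes all \<open>g\<close>
pairs. A row with \<open>u \<notin> Sol G\<close> contributes at least \<open>s + 2\<close> and at most \<open>g - 6\<close> pairs, and
summing gives \<open>s * g + (g - s) * (s + 2)\<close> and \<open>s * g + (g - s) * (g - 6)\<close>, which are the two
bounds multiplied by \<open>g\<^sup>2\<close>.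

The only group theory needed is that two elements \<open>x, y\<close> generate a solvable group as soon as
\<open>y\<close> conjugates \<open>x\<close> into the cyclic group of \<open>x\<close>: this cyclic group is then normal, with cyclic
quotient. In particular commuting elements, and pairs of involutions (a dihedral group), generate
solvable groups.

The bound \<open>s + 2\<close> (\<open>card_solvable_partners_ge\<close>). Besides \<open>Sol G\<close>, the partners of \<open>u\<close> include \<open>u\<close>
itself and a second element outside \<open>Sol G\<close>: the inverse of \<open>u\<close>, or, if \<open>u\<close> is an involution, a
conjugate of \<open>u\<close> different from \<open>u\<close>. Such a conjugate exists because a central element lies in
\<open>Sol G\<close>.

The bound \<open>g - 6\<close> (\<open>card_nonsolvable_partners_ge\<close>). Some \<open>y\<close> generates with \<open>u\<close> a nonsolvable group,
and the set of all such \<open>y\<close> is a union of right cosets of the cyclic group \<open>U\<close> of \<open>u\<close>. The cosets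
\<open>U y\<close> and \<open>U y u\<close> differ, since otherwise \<open>y\<close> would conjugate \<open>u\<close> into \<open>U\<close>. If \<open>u\<close> has order at
least 3, these two cosets already contain 6 elements. If \<open>u\<close> is an involution, the coset of the
inverse of \<open>y\<close> is a third one, since a coincidence would turn the generated group into an abelian
or a dihedral one; three cosets of size 2 again give 6 elements.\<close>

section \<open>Two-generator groups with a normal cyclic subgroup\<close>

lemma (in group) comm_group_if_generators_commute:
  assumes S: "S \<subseteq> carrier G" and gen: "carrier G = generate G S"
    and comm: "\<And>a b. \<lbrakk>a \<in> S; b \<in> S\<rbrakk> \<Longrightarrow> a \<otimes> b = b \<otimes> a"
  shows "comm_group G"
proof -
  have commutes_inv: "a \<otimes> inv b = inv b \<otimes> a"
    if "a \<otimes> b = b \<otimes> a" "a \<in> carrier G" "b \<in> carrier G" for a b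
    using that by (metis inv_closed inv_solve_left inv_solve_right m_assoc m_closed)
  have commutes_mult: "a \<otimes> (b \<otimes> c) = (b \<otimes> c) \<otimes> a"
    if "a \<otimes> b = b \<otimes> a" "a \<otimes> c = c \<otimes> a" "a \<in> carrier G" "b \<in> carrier G" "c \<in> carrier G" for a b c
    using that by (metis m_assoc)
  have commutes_gen: "a \<otimes> g = g \<otimes> a"
    if "g \<in> generate G S" "a \<in> carrier G" and ab: "\<And>b. b \<in> S \<Longrightarrow> a \<otimes> b = b \<otimes> a" for a g
    using that(1)
  proof (induction g)
    case one
    then show ?case using that(2) by simp
  next
    case (incl h)
    then show ?case by (rule ab)
  next
    case (inv h)
    then show ?case using commutes_inv ab that(2) S by blast
  next
    case (eng h1 h2)
    then show ?case using commutes_mult that(2) gen by blast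
  qed
  have "g \<otimes> h = h \<otimes> g" if "g \<in> carrier G" "h \<in> carrier G" for g h
  proof -
    have "g \<otimes> b = b \<otimes> g" if "b \<in> S" for b
      using commutes_gen[of g b] \<open>g \<in> carrier G\<close> gen comm that S by (metis subsetD)
    then show ?thesis
      using commutes_gen[of h g] that gen by blast
  qed
  then show ?thesis by (rule group_comm_groupI)
qed

lemma (in group) conjugation_hom:
  assumes "g \<in> carrier G"
  shows "group_hom G G (\<lambda>h. g \<otimes> h \<otimes> inv g)"
    and "inj_on (\<lambda>h. g \<otimes> h \<otimes> inv g) (carrier G)"
proof -
  have "g \<otimes> (a \<otimes> b) \<otimes> inv g = g \<otimes> a \<otimes> inv g \<otimes> (g \<otimes> b \<otimes> inv g)"
    if "a \<in> carrier G" "b \<in> carrier G" for a b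
    using assms that by (simp add: inv_solve_left m_assoc)
  then show "group_hom G G (\<lambda>h. g \<otimes> h \<otimes> inv g)"
    using assms by (auto simp: group_hom_def group_hom_axioms_def hom_def is_group)
  show "inj_on (\<lambda>h. g \<otimes> h \<otimes> inv g) (carrier G)"
    using assms by (auto simp: inj_on_def)
qed

text \<open>Conjugation by \<open>y\<close> maps the cyclic group of \<open>x\<close> injectively into itself. Finiteness makes this map
onto, so that the inverse of \<open>y\<close> normalizes the cyclic group too.\<close>

lemma (in group) cyclic_normal_if_conjugate_in:
  assumes fin: "finite (carrier G)" and x: "x \<in> carrier G" and y: "y \<in> carrier G"
    and gen: "carrier G = generate G {x, y}"
    and conj: "y \<otimes> x \<otimes> inv y \<in> generate G {x}"
  shows "generate G {x} \<lhd> G"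
proof -
  let ?K = "generate G {x}"
  have K: "subgroup ?K G" using x by (simp add: generate_is_subgroup)
  then have KG: "?K \<subseteq> carrier G" by (rule subgroup.subset)
  interpret c: group_hom G G "\<lambda>h. y \<otimes> h \<otimes> inv y" by (rule conjugation_hom[OF y])
  have "(\<lambda>h. y \<otimes> h \<otimes> inv y) ` ?K \<subseteq> ?K"
    using generate_subgroup_incl[OF _ K, of "{y \<otimes> x \<otimes> inv y}"] conj c.generate_img[of "{x}"] x
    by simp
  moreover have "inj_on (\<lambda>h. y \<otimes> h \<otimes> inv y) ?K"
    using conjugation_hom(2)[OF y] KG by (rule inj_on_subset)
  ultimately have yK: "(\<lambda>h. y \<otimes> h \<otimes> inv y) ` ?K = ?K"
    using finite_subset[OF KG fin] by (rule endo_inj_surj[rotated])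
  have normalize: "g \<otimes> k \<otimes> inv g \<in> ?K" if "g \<in> generate G {x, y}" "k \<in> ?K" for g k
    using that
  proof (induction g arbitrary: k)
    case one
    then show ?case using KG by auto
  next
    case (incl h)
    then show ?case
      using yK K generate.incl[of x "{x}" G] by (auto simp: subgroup.m_closed subgroup.m_inv_closed)
  next
    case (inv h)
    show ?case
    proof (cases "h = x")
      case True
      then show ?thesis
        using K generate.incl[of x "{x}" G] inv.prems
        by (auto simp: subgroup.m_closed subgroup.m_inv_closed)
    next
      case False
      with inv have h: "h = y" by simp
      obtain k' where k': "k' \<in> ?K" "k = y \<otimes> k' \<otimes> inv y"
        using yK inv.prems by (metis (no_types, lifting) imageE)
      then have "inv y \<otimes> k \<otimes> inv (inv y) = k'"
        using y KG by (metis conjugation_hom(2) inv_closed inv_inv inv_solve_left inv_solve_right m_assoc m_closed subsetD)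
      then show ?thesis using k' h by simp
    qed
  next
    case (eng h1 h2)
    have "h1 \<in> carrier G" "h2 \<in> carrier G" "k \<in> carrier G"
      using eng gen KG by auto
    then have "h1 \<otimes> h2 \<otimes> k \<otimes> inv (h1 \<otimes> h2) = h1 \<otimes> (h2 \<otimes> k \<otimes> inv h2) \<otimes> inv h1"
      by (simp add: inv_mult_group m_assoc)
    then show ?case using eng by simp
  qed
  show ?thesis
    using normal_invI[OF K] normalize gen by blast
qed

text \<open>The quotient by the normal cyclic group of \<open>x\<close> is generated by the trivial coset of \<open>x\<close> and the
coset of \<open>y\<close>, hence it is abelian.\<close>

lemma (in group) solvable_if_cyclic_by_cyclic:
  assumes fin: "finite (carrier G)" and x: "x \<in> carrier G" and y: "y \<in> carrier G"
    and gen: "carrier G = generate G {x, y}"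
    and conj: "y \<otimes> x \<otimes> inv y \<in> generate G {x}"
  shows "solvable G"
proof -
  let ?K = "generate G {x}"
  have K: "subgroup ?K G" using x by (simp add: generate_is_subgroup)
  interpret K: normal ?K G using cyclic_normal_if_conjugate_in[OF assms] .
  interpret KG: group "G\<lparr>carrier := ?K\<rparr>" by (rule subgroup_imp_group[OF K])
  have "comm_group (G\<lparr>carrier := ?K\<rparr>)"
    using KG.comm_group_if_generators_commute[of "{x}"] generate_consistent[OF _ K, of "{x}"]
      generate.incl[of x "{x}" G] by auto
  then interpret KC: comm_group "G\<lparr>carrier := ?K\<rparr>" .
  have "derived G ?K = {\<one>}"
    using KC.derived_eq_singleton[of ?K] derived_consistent[OF _ K, of ?K] by simp
  then have "solvable_seq G ?K"
    using trivial_derived_seq_imp_solvable[OF K, of 1] by simp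
  moreover have "comm_group (G Mod ?K)"
  proof -
    interpret q: group_hom G "G Mod ?K" "\<lambda>a. ?K #> a"
      using K.r_coset_hom_Mod by (simp add: group_hom_def group_hom_axioms_def is_group K.factorgroup_is_group)
    have "carrier (G Mod ?K) = (\<lambda>a. ?K #> a) ` generate G {x, y}"
      using gen by (auto simp: FactGroup_def RCOSETS_def)
    then have "carrier (G Mod ?K) = generate (G Mod ?K) {?K #> x, ?K #> y}"
      using q.generate_img[of "{x,y}"] x y by simp
    moreover have "?K #> x = \<one>\<^bsub>G Mod ?K\<^esub>"
      using coset_join2[OF x K] generate.incl[of x "{x}" G] by simp
    ultimately have "carrier (G Mod ?K) = generate (G Mod ?K) {\<one>\<^bsub>G Mod ?K\<^esub>, ?K #> y}"
      by simp
    then show ?thesis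
    proof (rule q.H.comm_group_if_generators_commute[rotated])
      show "{\<one>\<^bsub>G Mod ?K\<^esub>, ?K #> y} \<subseteq> carrier (G Mod ?K)"
        using q.hom_closed[OF y] q.H.one_closed by blast
      show "a \<otimes>\<^bsub>G Mod ?K\<^esub> b = b \<otimes>\<^bsub>G Mod ?K\<^esub> a"
        if "a \<in> {\<one>\<^bsub>G Mod ?K\<^esub>, ?K #> y}" "b \<in> {\<one>\<^bsub>G Mod ?K\<^esub>, ?K #> y}" for a b
        using that q.H.l_one[OF q.hom_closed[OF y]] q.H.r_one[OF q.hom_closed[OF y]] by blast
    qed
  qed
  ultimately show ?thesis
    unfolding solvable_def
    using solvable_seq.extension[of G ?K "carrier G"] K.normal_axioms subgroup_self by simp
qed

section \<open>Solvable two-generator subgroups\<close>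

abbreviation solvable_pair :: "('a, 'b) monoid_scheme \<Rightarrow> 'a \<Rightarrow> 'a \<Rightarrow> bool"
  where "solvable_pair G x y \<equiv> solvable (subgroup_generated G {x, y})"

text \<open>Solvability passes to subgroups, and an injective homomorphism identifies the group generated by
\<open>a, b\<close> with the one generated by their images. Taking the identity yields monotonicity below, and
taking a conjugation yields that \<open>Sol G\<close> is closed under conjugation.\<close>

lemma (in group) solvable_pair_if_embeds:
  assumes hom: "group_hom G G h" and inj: "inj_on h (carrier G)"
    and "a \<in> carrier G" "b \<in> carrier G" "c \<in> carrier G" "d \<in> carrier G"
    and "h a \<in> generate G {c, d}" "h b \<in> generate G {c, d}"
    and solv: "solvable_pair G c d"
  shows "solvable_pair G a b"
proof -
  interpret h: group_hom G G h by (rule hom)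
  have "h ` generate G {a, b} \<subseteq> generate G {c, d}"
    using h.generate_img[of "{a, b}"] generate_subgroup_incl[of "{h a, h b}" "generate G {c, d}"]
      assms by (simp add: generate_is_subgroup)
  then have "group_hom (subgroup_generated G {a, b}) (subgroup_generated G {c, d}) h"
    using assms h.homh hom_from_subgroup_generated[of h G "{a, b}"]
    by (auto simp: group_hom_def group_hom_axioms_def hom_into_subgroup_eq_gen[OF is_group]
        carrier_subgroup_generated)
  then show ?thesis
    using group_hom.inj_hom_imp_solvable solv inj_on_subset[OF inj carrier_subgroup_generated_subset]
    by blast
qed

lemma (in group) solvable_pair_mono:
  assumes "c \<in> carrier G" "d \<in> carrier G" "solvable_pair G c d"
    and "a \<in> generate G {c, d}" "b \<in> generate G {c, d}"
  shows "solvable_pair G a b"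
proof -
  have "group_hom G G (\<lambda>z. z)"
    by (simp add: group_hom_def group_hom_axioms_def hom_def is_group)
  then show ?thesis
    using solvable_pair_if_embeds[of "\<lambda>z. z" a b c d] assms generate_in_carrier[of "{c, d}"] by auto
qed

lemma (in group) solvable_pair_if_conjugate_in:
  assumes fin: "finite (carrier G)" and x: "x \<in> carrier G" and y: "y \<in> carrier G"
    and conj: "y \<otimes> x \<otimes> inv y \<in> generate G {x}"
  shows "solvable_pair G x y"
proof -
  let ?L = "subgroup_generated G {x, y}"
  have L: "?L = G\<lparr>carrier := generate G {x, y}\<rparr>"
    using x y by (simp add: subgroup_generated_def)
  have sub: "subgroup (generate G {x, y}) G" using x y by (simp add: generate_is_subgroup)
  have in_L: "x \<in> carrier ?L" "y \<in> carrier ?L"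
    by (auto simp: L generate.incl)
  interpret L: group ?L by simp
  have gen: "generate ?L {x} = generate G {x}" "generate ?L {x, y} = generate G {x, y}"
    unfolding L by (rule generate_consistent[OF _ sub]; auto simp: generate.incl)+
  show ?thesis
  proof (rule L.solvable_if_cyclic_by_cyclic[OF _ in_L])
    show "finite (carrier ?L)"
      using fin carrier_subgroup_generated_subset by (rule finite_subset[rotated])
    show "carrier ?L = generate ?L {x, y}" unfolding gen by (simp add: L)
    show "y \<otimes>\<^bsub>?L\<^esub> x \<otimes>\<^bsub>?L\<^esub> inv\<^bsub>?L\<^esub> y \<in> generate ?L {x}"
      using conj gen in_L by simp
  qed
qed

lemma (in group) solvable_pair_if_commute:
  assumes "finite (carrier G)" "x \<in> carrier G" "y \<in> carrier G" "y \<otimes> x = x \<otimes> y"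
  shows "solvable_pair G x y"
  using assms solvable_pair_if_conjugate_in[of x y] generate.incl[of x "{x}" G]
  by (simp add: m_assoc)

text \<open>The involution \<open>a\<close> inverts the product \<open>a \<otimes> b\<close>, so it normalizes the cyclic group of \<open>a \<otimes> b\<close>.\<close>

lemma (in group) solvable_pair_involutions:
  assumes fin: "finite (carrier G)" and a: "a \<in> carrier G" "a \<otimes> a = \<one>"
    and b: "b \<in> carrier G" "b \<otimes> b = \<one>"
  shows "solvable_pair G a b"
proof -
  have inv: "inv a = a" "inv b = b" using a b by (auto intro: inv_equality)
  have "a \<otimes> (a \<otimes> b) \<otimes> inv a = inv (a \<otimes> b)"
    using a b inv by (simp add: inv_mult_group m_assoc[symmetric])
  then have "solvable_pair G (a \<otimes> b) a"
    using solvable_pair_if_conjugate_in[of "a \<otimes> b" a] fin a b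
      generate.inv[of "a \<otimes> b" "{a \<otimes> b}" G] by simp
  moreover have "b = a \<otimes> (a \<otimes> b)"
    using a b by (simp add: m_assoc[symmetric])
  then have "b \<in> generate G {a \<otimes> b, a}"
    using generate.eng[OF generate.incl generate.incl, of a "{a \<otimes> b, a}" "a \<otimes> b" G] by simp
  ultimately show ?thesis
    using solvable_pair_mono[of "a \<otimes> b" a a b] a b by (simp add: generate.incl)
qed

section \<open>The elements outside \<open>Sol G\<close>\<close>

lemma (in group) Sol_I:
  assumes "x \<in> carrier G" "\<And>y. y \<in> carrier G \<Longrightarrow> solvable_pair G x y"
  shows "x \<in> Sol G"
  using assms by (simp add: Sol_def)

lemma (in group) inv_in_Sol_iff:
  assumes "x \<in> carrier G"
  shows "inv x \<in> Sol G \<longleftrightarrow> x \<in> Sol G"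
proof -
  have *: "inv z \<in> Sol G" if "z \<in> Sol G" for z
  proof (rule Sol_I)
    show "inv z \<in> carrier G" using that by (simp add: Sol_def)
    show "solvable_pair G (inv z) y" if "y \<in> carrier G" for y
      using solvable_pair_mono[of z y "inv z" y] \<open>z \<in> Sol G\<close> that
      by (simp add: Sol_def generate.incl generate.inv)
  qed
  show ?thesis using *[of x] *[of "inv x"] assms by auto
qed

lemma (in group) Sol_if_conjugate_in_Sol:
  assumes x: "x \<in> carrier G" and g: "g \<in> carrier G" and conj: "g \<otimes> x \<otimes> inv g \<in> Sol G"
  shows "x \<in> Sol G"
proof (rule Sol_I[OF x])
  fix y assume y: "y \<in> carrier G"
  have "solvable_pair G (g \<otimes> x \<otimes> inv g) (g \<otimes> y \<otimes> inv g)"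
    using conj g y by (simp add: Sol_def)
  then show "solvable_pair G x y"
    using x y g by (intro solvable_pair_if_embeds[OF conjugation_hom[OF g] x y])
      (auto intro: generate.incl)
qed

text \<open>An element that is not an involution has its inverse as partner. The conjugates of an involution
are involutions, with which it generates a dihedral group; if all of them were equal to \<open>u\<close>, then
\<open>u\<close> would be central and therefore in \<open>Sol G\<close>.\<close>

lemma (in group) solvable_partner_outside_Sol:
  assumes fin: "finite (carrier G)" and u: "u \<in> carrier G" "u \<notin> Sol G"
  obtains w where "w \<in> carrier G" "w \<notin> Sol G" "w \<noteq> u" "solvable_pair G u w"
proof (cases "u \<otimes> u = \<one>")
  case False
  then have "inv u \<noteq> u" using u r_inv by metis
  moreover have "solvable_pair G u (inv u)"
    using fin u by (intro solvable_pair_if_commute) simp_all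
  ultimately show thesis using that[of "inv u"] u inv_in_Sol_iff by simp
next
  case True
  have "\<exists>g \<in> carrier G. g \<otimes> u \<otimes> inv g \<noteq> u"
  proof (rule ccontr)
    assume "\<not> ?thesis"
    then have "g \<otimes> u = u \<otimes> g" if "g \<in> carrier G" for g
      using that u by (metis inv_solve_right m_closed)
    then show False
      using u Sol_I[OF u(1)] solvable_pair_if_commute[OF fin u(1)] by blast
  qed
  then obtain g where g: "g \<in> carrier G" "g \<otimes> u \<otimes> inv g \<noteq> u" by blast
  interpret c: group_hom G G "\<lambda>h. g \<otimes> h \<otimes> inv g" by (rule conjugation_hom[OF g(1)])
  have "(g \<otimes> u \<otimes> inv g) \<otimes> (g \<otimes> u \<otimes> inv g) = \<one>"
    using c.hom_mult[of u u] True u g by simp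
  then show thesis
    using that[of "g \<otimes> u \<otimes> inv g"] g u True Sol_if_conjugate_in_Sol[OF u(1) g(1)]
      solvable_pair_involutions[OF fin u(1) True] by auto
qed

lemma (in group) card_solvable_partners_ge:
  assumes fin: "finite (carrier G)" and u: "u \<in> carrier G" "u \<notin> Sol G"
  shows "card (Sol G) + 2 \<le> card {v \<in> carrier G. solvable_pair G u v}"
proof -
  obtain w where w: "w \<in> carrier G" "w \<notin> Sol G" "w \<noteq> u" "solvable_pair G u w"
    using solvable_partner_outside_Sol[OF assms] .
  have "solvable_pair G u v" if "v \<in> Sol G" for v
    using that u by (simp add: Sol_def insert_commute[of u v])
  then have sub: "Sol G \<union> {u, w} \<subseteq> {v \<in> carrier G. solvable_pair G u v}"
    using u w solvable_pair_if_commute[OF fin u(1) u(1)] by (auto simp: Sol_def)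
  have "finite (Sol G)"
    using fin by (rule finite_subset[rotated]) (auto simp: Sol_def)
  then have "card (Sol G \<union> {u, w}) = card (Sol G) + 2"
    using u w by simp
  then show ?thesis
    using card_mono[OF _ sub] fin by simp
qed

text \<open>The product set is the disjoint union of the right cosets of \<open>K\<close> that the elements of \<open>T\<close> represent.\<close>

lemma (in group) card_mult_transversal:
  assumes K: "subgroup K G" and T: "T \<subseteq> carrier G"
    and distinct: "\<And>s t. \<lbrakk>s \<in> T; t \<in> T; s \<otimes> inv t \<in> K\<rbrakk> \<Longrightarrow> s = t"
  shows "card ((\<lambda>(k, t). k \<otimes> t) ` (K \<times> T)) = card K * card T"
proof -
  have "inj_on (\<lambda>(k, t). k \<otimes> t) (K \<times> T)"
  proof (clarsimp simp: inj_on_def)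
    fix k s l t assume *: "k \<in> K" "s \<in> T" "l \<in> K" "t \<in> T" "k \<otimes> s = l \<otimes> t"
    then have c: "k \<in> carrier G" "l \<in> carrier G" "s \<in> carrier G" "t \<in> carrier G"
      using T subgroup.subset[OF K] by auto
    have "inv k \<otimes> l = s \<otimes> inv t"
      using * c by (metis inv_closed inv_solve_left inv_solve_right m_assoc m_closed)
    then have "s \<otimes> inv t \<in> K"
      using K * by (metis subgroup.m_closed subgroup.m_inv_closed)
    then have "s = t" using distinct * by blast
    then show "k = l \<and> s = t" using * c by simp
  qed
  then show ?thesis by (simp add: card_image card_cartesian_product)
qed

text \<open>The nonsolvable partners of \<open>u\<close> form a union of right cosets of the cyclic group of \<open>u\<close>: if \<open>k\<close> is a
power of \<open>u\<close>, then \<open>u\<close> and \<open>k \<otimes> t\<close> generate the same group as \<open>u\<close> and \<open>t\<close>.\<close>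

lemma (in group) card_mult_transversal_le_nonsolvable_partners:
  assumes fin: "finite (carrier G)" and u: "u \<in> carrier G" and T: "T \<subseteq> carrier G"
    and nonsolv: "\<And>t. t \<in> T \<Longrightarrow> \<not> solvable_pair G u t"
    and distinct: "\<And>s t. \<lbrakk>s \<in> T; t \<in> T; s \<otimes> inv t \<in> generate G {u}\<rbrakk> \<Longrightarrow> s = t"
  shows "card (generate G {u}) * card T \<le> card {v \<in> carrier G. \<not> solvable_pair G u v}"
proof -
  let ?K = "generate G {u}"
  have K: "subgroup ?K G" using u by (simp add: generate_is_subgroup)
  have "\<not> solvable_pair G u (k \<otimes> t)" if k: "k \<in> ?K" and t: "t \<in> T" for k t
  proof
    assume solv: "solvable_pair G u (k \<otimes> t)"
    have c: "k \<in> carrier G" "t \<in> carrier G" using k t T subgroup.subset[OF K] by auto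
    have "k \<in> generate G {u, k \<otimes> t}"
      using k mono_generate[of "{u}" "{u, k \<otimes> t}"] by blast
    then have "inv k \<otimes> (k \<otimes> t) \<in> generate G {u, k \<otimes> t}"
      using u c generate_m_inv_closed[of "{u, k \<otimes> t}" k] by (simp add: generate.eng generate.incl)
    then have "t \<in> generate G {u, k \<otimes> t}"
      using c by (simp add: m_assoc[symmetric])
    then show False
      using solvable_pair_mono[OF u _ solv, of u t] nonsolv[OF t] c by (simp add: generate.incl)
  qed
  then have sub: "(\<lambda>(k, t). k \<otimes> t) ` (?K \<times> T) \<subseteq> {v \<in> carrier G. \<not> solvable_pair G u v}"
    using T subgroup.subset[OF K] by auto
  have "card ?K * card T = card ((\<lambda>(k, t). k \<otimes> t) ` (?K \<times> T))"
    using card_mult_transversal[OF K T distinct] by simp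
  also have "\<dots> \<le> card {v \<in> carrier G. \<not> solvable_pair G u v}"
    using fin by (intro card_mono[OF _ sub]) simp
  finally show ?thesis .
qed

lemma (in group) generate_singleton_involution:
  assumes "u \<in> carrier G" "u \<otimes> u = \<one>"
  shows "generate G {u} = {\<one>, u}"
proof -
  have "inv u = u" using assms by (simp add: inv_equality)
  then have "subgroup {\<one>, u} G" using assms by (intro subgroupI) auto
  then show ?thesis
    using generate_subgroup_incl[of "{u}" "{\<one>, u}"] by (auto intro: generate.intros)
qed

text \<open>The representatives \<open>y\<close> and \<open>y \<otimes> u\<close> of right cosets of the cyclic group of \<open>u\<close> suffice if \<open>u\<close> has
order at least 3; for an involution they are joined by \<open>inv y\<close>. In each case a coincidence of two
of the cosets puts one of \<open>y \<otimes> u \<otimes> inv y\<close>, \<open>y \<otimes> y\<close>, \<open>y \<otimes> u \<otimes> y\<close> into the cyclic group of \<open>u\<close>, and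
each of these would make the group generated by \<open>u\<close> and \<open>y\<close> solvable.\<close>

lemma (in group) card_nonsolvable_partners_ge:
  assumes fin: "finite (carrier G)" and u: "u \<in> carrier G" "u \<notin> Sol G"
  shows "6 \<le> card {v \<in> carrier G. \<not> solvable_pair G u v}"
proof -
  let ?K = "generate G {u}"
  have K: "subgroup ?K G" using u by (simp add: generate_is_subgroup)
  have finK: "finite ?K" using subgroup.subset[OF K] fin by (rule finite_subset)
  obtain y where y: "y \<in> carrier G" "\<not> solvable_pair G u y"
    using u Sol_I by blast
  have uK: "\<one> \<in> ?K" "u \<in> ?K" "inv u \<in> ?K" by (auto intro: generate.intros)
  have u1: "u \<noteq> \<one>" using y solvable_pair_if_commute[OF fin u(1) y(1)] by auto
  have yuy: "y \<otimes> u \<otimes> inv y \<notin> ?K"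
    using y solvable_pair_if_conjugate_in[OF fin u(1) y(1)] by blast
  have in_yu: "y \<in> generate G {u, y \<otimes> u}"
  proof -
    have "y = (y \<otimes> u) \<otimes> inv u" using u y by (simp add: m_assoc)
    then show ?thesis by (metis generate.eng generate.incl generate.inv insertI1 insertI2)
  qed
  have yu: "\<not> solvable_pair G u (y \<otimes> u)"
    using solvable_pair_mono[of u "y \<otimes> u" u y] u y in_yu by (auto simp: generate.incl)
  have yu_y: "y \<otimes> inv (y \<otimes> u) \<notin> ?K"
  proof
    assume "y \<otimes> inv (y \<otimes> u) \<in> ?K"
    then have "inv (y \<otimes> inv (y \<otimes> u)) \<in> ?K" using K by (rule subgroup.m_inv_closed[rotated])
    then show False using yuy u y by (simp add: inv_mult_group)
  qed
  have neq: "y \<noteq> y \<otimes> u" using u y u1 by simp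
  show ?thesis
  proof (cases "u \<otimes> u = \<one>")
    case False
    have "inv u \<noteq> u" using False u r_inv by metis
    moreover have "inv u \<noteq> \<one>" using u u1 by simp
    ultimately have "card {\<one>, u, inv u} = 3" using u1 by auto
    then have "3 \<le> card ?K"
      using uK card_mono[OF finK, of "{\<one>, u, inv u}"] by simp
    moreover have "card ?K * card {y, y \<otimes> u} \<le> card {v \<in> carrier G. \<not> solvable_pair G u v}"
      using u y yu yuy yu_y by (intro card_mult_transversal_le_nonsolvable_partners[OF fin]) auto
    ultimately show ?thesis using neq by simp
  next
    case True
    have K_eq: "?K = {\<one>, u}" using generate_singleton_involution u True by blast
    have iu: "inv u = u" using True u by (simp add: inv_equality)
    have yy: "y \<otimes> y \<notin> ?K"
    proof
      assume "y \<otimes> y \<in> ?K"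
      then consider "y \<otimes> y = \<one>" | "y \<otimes> y = u" using K_eq by blast
      then show False
      proof cases
        case 1
        then show ?thesis using solvable_pair_involutions[OF fin u(1) True y(1)] y by blast
      next
        case 2
        then have "y \<otimes> u = u \<otimes> y" using y by (metis m_assoc)
        then show ?thesis using solvable_pair_if_commute[OF fin u(1) y(1)] y by blast
      qed
    qed
    have yuy': "y \<otimes> u \<otimes> y \<notin> ?K"
    proof
      assume "y \<otimes> u \<otimes> y \<in> ?K"
      then consider "y \<otimes> u \<otimes> y = \<one>" | "y \<otimes> u \<otimes> y = u" using K_eq by blast
      then show False
      proof cases
        case 1
        \<comment> \<open>Here \<open>u\<close> is the inverse of \<open>y \<otimes> y\<close>, so it commutes with \<open>y\<close>.\<close>
        have "y \<otimes> u = inv y" using 1 u y by (simp add: inv_equality)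
        then have "y \<otimes> u \<otimes> y = y \<otimes> (y \<otimes> u)" using y by simp
        then have "u \<otimes> y = y \<otimes> u" using u y by (simp add: m_assoc)
        then show ?thesis using solvable_pair_if_commute[OF fin u(1) y(1)] y by simp
      next
        case 2
        \<comment> \<open>Now \<open>y \<otimes> u\<close> is an involution, and with \<open>u\<close> it generates the same group as \<open>y\<close> does.\<close>
        then have "(y \<otimes> u) \<otimes> (y \<otimes> u) = \<one>" using u y True by (simp add: m_assoc[symmetric])
        then show ?thesis using solvable_pair_involutions[OF fin u(1) True, of "y \<otimes> u"] u y yu by blast
      qed
    qed
    have inv_y: "\<not> solvable_pair G u (inv y)"
      using solvable_pair_mono[of u "inv y" u y] u y generate.inv[of "inv y" "{u, inv y}" G]
      by (auto simp: generate.incl)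
    have closed: "z \<in> ?K" if "inv z \<in> ?K" "z \<in> carrier G" for z
      using that subgroup.m_inv_closed[OF K] by fastforce
    have "inv y \<otimes> inv y \<notin> ?K" using closed[of "y \<otimes> y"] yy y by (auto simp: inv_mult_group)
    moreover have "inv y \<otimes> inv (y \<otimes> u) \<notin> ?K"
      using closed[of "y \<otimes> u \<otimes> y"] yuy' u y by (auto simp: inv_mult_group)
    moreover have "y \<noteq> inv y" using yy uK y r_inv by metis
    moreover have "y \<otimes> u \<noteq> inv y" using yuy' uK u y l_inv by metis
    ultimately have "card ?K * card {y, y \<otimes> u, inv y} \<le> card {v \<in> carrier G. \<not> solvable_pair G u v}"
      using u y yu yuy yu_y yy yuy' inv_y
      by (intro card_mult_transversal_le_nonsolvable_partners[OF fin]) auto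
    moreover have "card {y, y \<otimes> u, inv y} = 3"
      using neq \<open>y \<noteq> inv y\<close> \<open>y \<otimes> u \<noteq> inv y\<close> by simp
    moreover have "card ?K = 2" using K_eq u1 by simp
    ultimately show ?thesis by simp
  qed
qed

theorem theorem2p2:
  fixes G :: "('a, 'b) monoid_scheme"
  assumes "group G" and "finite (carrier G)" and "\<not> solvable G"
  shows "2 * (real (order G) - real (card (Sol G))) / (real (order G))\<^sup>2
           + 2 * real (card (Sol G)) / real (order G)
           - (real (card (Sol G)))\<^sup>2 / (real (order G))\<^sup>2
         \<le> solvability_degree G
         \<and> solvability_degree G
         \<le> 1 - 6 * (real (order G) - real (card (Sol G))) / (real (order G))\<^sup>2"
proof -
  interpret group G by fact
  note fin = assms(2)
  define g s where "g = real (order G)" and "s = real (card (Sol G))"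
  let ?partners = "\<lambda>u. {v \<in> carrier G. solvable_pair G u v}"
  let ?pairs = "{(u, v) \<in> carrier G \<times> carrier G. solvable_pair G u v}"
  have Sol_sub: "Sol G \<subseteq> carrier G" by (auto simp: Sol_def)
  then have finS: "finite (Sol G)" using fin by (rule finite_subset)
  have g0: "g > 0" using fin by (simp add: g_def order_gt_0_iff_finite)
  have "?pairs = Sigma (carrier G) ?partners" by auto
  then have "real (card ?pairs) = (\<Sum>u \<in> carrier G. real (card (?partners u)))"
    using fin by (simp add: card_SigmaI)
  also have "\<dots> = (\<Sum>u \<in> carrier G - Sol G. real (card (?partners u)))
      + (\<Sum>u \<in> Sol G. real (card (?partners u)))"
    using sum.subset_diff[OF Sol_sub fin] .
  also have "(\<Sum>u \<in> Sol G. real (card (?partners u))) = s * g"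
  proof -
    have "?partners u = carrier G" if "u \<in> Sol G" for u using that by (auto simp: Sol_def)
    then show ?thesis by (simp add: s_def g_def order_def)
  qed
  finally have pairs: "real (card ?pairs)
      = (\<Sum>u \<in> carrier G - Sol G. real (card (?partners u))) + s * g" .
  have card_rest: "real (card (carrier G - Sol G)) = g - s"
    using Sol_sub finS fin
    by (simp add: g_def s_def order_def card_Diff_subset card_mono of_nat_diff)
  have "s + 2 \<le> real (card (?partners u))" if "u \<in> carrier G - Sol G" for u
    using card_solvable_partners_ge[OF fin, of u] that by (simp add: s_def)
  from sum_bounded_below[of "carrier G - Sol G", OF this]
  have lower: "(g - s) * (s + 2) + s * g \<le> real (card ?pairs)"
    unfolding pairs using card_rest by simp
  have "real (card (?partners u)) \<le> g - 6" if "u \<in> carrier G - Sol G" for u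
  proof -
    have "?partners u \<union> {v \<in> carrier G. \<not> solvable_pair G u v} = carrier G" by auto
    then have "order G = card (?partners u) + card {v \<in> carrier G. \<not> solvable_pair G u v}"
      using card_Un_disjoint[of "?partners u" "{v \<in> carrier G. \<not> solvable_pair G u v}"] fin
      by (simp add: order_def disjoint_iff)
    then show ?thesis
      using card_nonsolvable_partners_ge[OF fin, of u] that by (simp add: g_def)
  qed
  from sum_bounded_above[of "carrier G - Sol G", OF this]
  have upper: "real (card ?pairs) \<le> (g - s) * (g - 6) + s * g"
    unfolding pairs using card_rest by simp
  have deg: "solvability_degree G = real (card ?pairs) / g\<^sup>2"
    by (simp add: solvability_degree_def g_def)
  have "2 * (g - s) / g\<^sup>2 + 2 * s / g - s\<^sup>2 / g\<^sup>2 = ((g - s) * (s + 2) + s * g) / g\<^sup>2"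
    using g0 by (simp add: field_simps power2_eq_square)
  moreover have "1 - 6 * (g - s) / g\<^sup>2 = ((g - s) * (g - 6) + s * g) / g\<^sup>2"
    using g0 by (simp add: field_simps power2_eq_square)
  ultimately show ?thesis
    unfolding deg g_def[symmetric] s_def[symmetric]
    using lower upper by (simp add: divide_right_mono)
qed

end
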